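(* Let $Z=\mathbb{R}^K\times\mathbb{R}$ and let $\mathcal{P}$ be a statistical model on $Z^{\infty}$ equipped with an ATTS sequence of statistics $(S_n)$. If the sequence of observations $(\mathbf{x}_n,y_n)$, $n=1,2,\ldots$, is generated by a probability distribution $P\in\mathcal{P}$ and a smoothed conformal predictor is fed with random numbers $(\tau_1,\tau_2,\ldots)\sim U^{\infty}$ independent of the observations, then the error sequence $\mathrm{err}_1^{\epsilon},\mathrm{err}_2^{\epsilon},\ldots$ at any significance level $\epsilon\in(0,1)$ is a sequence of independent identically distributed Bernoulli random variables with parameter $\epsilon$.
   Context: $U$ denotes the uniform distribution on $[0,1]$ and $U^{\infty}$ its infinite product. $K$ is the fixed number of explanatory variables; observations are $\zeta_i=(\mathbf{x}_i,y_i)\in Z=\mathbb{R}^K\times\mathbb{R}$. A statistical model $\mathcal{P}$ on $Z^{\infty}$ is a set of probability distributions on $Z^{\infty}$. Statistics $S_n:Z^n\to\Sigma_n$, $n=1,2,\ldots$, are measurable maps into measurable spaces with $\Sigma_n=S_n(Z^n)$; $\Sigma_0$ is a fixed one-element set (and $S_0$ is the constant with value in $\Sigma_0$). The sequence $(S_n)$ is algebraically transitive if there exist measurable functions $F_n:\Sigma_{n-1}\times Z\to\Sigma_n$, $n=2,3,\ldots$, such that $S_n(\zeta_1,\ldots,\zeta_n)=F_n(S_{n-1}(\zeta_1,\ldots,\zeta_{n-1}),\zeta_n)$ for all $(\zeta_1,\ldots,\zeta_n)\in Z^n$. The sequence $(S_n)$ is totally sufficient for $\mathcal{P}$ if, for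 each $n=1,2,\ldots$: (i) $S_n$ is sufficient for $\mathcal{P}$, i.e., there is a regular conditional distribution of $(\zeta_1,\ldots,\zeta_n)$ given $S_n(\zeta_1,\ldots,\zeta_n)$ that is the same for all $P\in\mathcal{P}$; and (ii) for any $P\in\mathcal{P}$, when $(\zeta_1,\zeta_2,\ldots)\sim P$, the sequences $\zeta_1,\ldots,\zeta_n$ and $\zeta_{n+1},\zeta_{n+2},\ldots$ are conditionally independent given $S_n(\zeta_1,\ldots,\zeta_n)$. An ATTS sequence is a sequence of statistics that is both algebraically transitive and totally sufficient. A nonconformity measure is any sequence of measurable functions $A_n:\Sigma_{n-1}\times Z\to\mathbb{R}$, $n=1,2,\ldots$. Given a nonconformity measure, for $\zeta_1,\zeta_2,\ldots\in Z$ and $\tau_1,\tau_2,\ldots\in[0,1]$ the $p$-values are $$p_n(\zeta_1,\ldots,\zeta_n,\tau_n):=\Pr\left(A_n^{\mathrm{rnd}}>A_n^{\mathrm{obs}}\mid S_n^{\mathrm{rnd}}=S_n^{\mathrm{obs}}\right)+\tau_n\Pr\left(A_n^{\mathrm{rnd}}=A_n^{\mathrm{obs}}\mid S_n^{\mathrm{rnd}}=S_n^{\mathrm{obs}}\right),$$ where $A_n^{\mathrm{rnd}}:=A_n(S_{n-1}(\xi_1,\ldots,\xi_{n-1}),\xi_n)$, $S_n^{\mathrm{rnd}}:=S_n(\xi_1,\ldots,\xi_n)$ are random, $A_n^{\mathrm{obs}}:=A_n(S_{n-1}(\zeta_1,\ldots,\zeta_{n-1}),\zeta_n)$, $S_n^{\mathrm{obs}}:=S_n(\zeta_1,\ldots,\zeta_n)$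 are the observed values treated as fixed, and the conditional probabilities are over $(\xi_1,\xi_2,\ldots)\sim P$, computed using the fixed common regular conditional distribution given $S_n$ (so they do not depend on $P\in\mathcal{P}$). The smoothed conformal predictor determined by $(A_n)$ outputs, at step $n$ and significance level $\epsilon$, the prediction region $$\Gamma_n^{\epsilon}=\Gamma^{\epsilon}(\mathbf{x}_1,y_1,\ldots,\mathbf{x}_{n-1},y_{n-1},\mathbf{x}_n,\tau_n):=\{y\in\mathbb{R}: p_n((\mathbf{x}_1,y_1),\ldots,(\mathbf{x}_{n-1},y_{n-1}),(\mathbf{x}_n,y),\tau_n)>\epsilon\}.$$ A smoothed conformal predictor is one determined by some nonconformity measure. The error indicator $\mathrm{err}_n^{\epsilon}$ equals $1$ if $y_n\notin\Gamma_n^{\epsilon}$ and $0$ otherwise. *)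

theory Defs
  imports "HOL-Probability.Probability"
begin

text \<open>
  Finite and infinite sequences are indexed from \<open>1\<close>: an element of \<open>Z\<^sup>n\<close> is an extensional
  function on \<open>{1..n}\<close>, an element of \<open>Z\<^sup>\<infinity>\<close> an extensional function on \<open>{1..}\<close>.  In particular
  \<open>Z\<^sup>0\<close> has exactly one element.
\<close>

type_synonym 'k obs = "(real ^ 'k) \<times> real"

abbreviation obs_fin :: "nat \<Rightarrow> (nat \<Rightarrow> 'k::finite obs) measure" where
  "obs_fin n \<equiv> PiM {1..n} (\<lambda>_. borel)"

abbreviation obs_inf :: "(nat \<Rightarrow> 'k::finite obs) measure" where
  "obs_inf \<equiv> PiM {1..} (\<lambda>_. borel)"

abbreviation unif_inf :: "(nat \<Rightarrow> real) measure" where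
  "unif_inf \<equiv> PiM {1..} (\<lambda>_. uniform_measure lborel {0..1})"

definition statistical_model :: "(nat \<Rightarrow> 'k::finite obs) measure set \<Rightarrow> bool" where
  "statistical_model \<P> \<longleftrightarrow> (\<forall>P\<in>\<P>. prob_space P \<and> sets P = sets obs_inf)"

text \<open>
  All statistics take values in one type \<open>'s\<close>; the space of possible values at step \<open>n\<close> is
  \<open>space (\<Sigma> n)\<close>, and only the \<open>\<sigma>\<close>-algebra of \<open>\<Sigma> n\<close> is relevant.  For \<open>n = 0\<close> the condition
  says that \<open>space (\<Sigma> 0)\<close> is a singleton and \<open>S 0\<close> its only possible value.
\<close>

definition statistics ::
  "(nat \<Rightarrow> 's measure) \<Rightarrow> (nat \<Rightarrow> (nat \<Rightarrow> 'k::finite obs) \<Rightarrow> 's) \<Rightarrow> bool" where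
  "statistics \<Sigma> S \<longleftrightarrow>
     (\<forall>n. S n \<in> measurable (obs_fin n) (\<Sigma> n) \<and> space (\<Sigma> n) = S n ` space (obs_fin n))"

definition algebraically_transitive ::
  "(nat \<Rightarrow> 's measure) \<Rightarrow> (nat \<Rightarrow> (nat \<Rightarrow> 'k::finite obs) \<Rightarrow> 's) \<Rightarrow> bool" where
  "algebraically_transitive \<Sigma> S \<longleftrightarrow>
     (\<exists>F. \<forall>n\<ge>2. F n \<in> measurable (\<Sigma> (n - 1) \<Otimes>\<^sub>M borel) (\<Sigma> n) \<and>
        (\<forall>z\<in>space (obs_fin n). S n z = F n (S (n - 1) (restrict z {1..n - 1}), z n)))"

text \<open>The conditional probability of the event \<open>A\<close> given the random element \<open>T\<close> of \<open>N\<close>.\<close>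

definition prob_given :: "'a measure \<Rightarrow> ('a \<Rightarrow> 'b) \<Rightarrow> 'b measure \<Rightarrow> 'a set \<Rightarrow> 'a \<Rightarrow> real" where
  "prob_given M T N A = real_cond_exp M (vimage_algebra (space M) T N) (indicator A)"

definition regular_cond_distr ::
  "'a measure \<Rightarrow> ('a \<Rightarrow> 'c) \<Rightarrow> 'c measure \<Rightarrow> ('a \<Rightarrow> 'b) \<Rightarrow> 'b measure \<Rightarrow> ('b \<Rightarrow> 'c measure) \<Rightarrow> bool"
where
  "regular_cond_distr M X L T N \<kappa> \<longleftrightarrow>
     \<kappa> \<in> measurable N (prob_algebra L) \<and>
     (\<forall>A\<in>sets L. AE \<omega> in M. measure (\<kappa> (T \<omega>)) A = prob_given M T N (X -` A \<inter> space M) \<omega>)"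

definition cond_indep_var ::
  "'a measure \<Rightarrow> 'c measure \<Rightarrow> ('a \<Rightarrow> 'c) \<Rightarrow> 'd measure \<Rightarrow> ('a \<Rightarrow> 'd) \<Rightarrow> 'b measure \<Rightarrow> ('a \<Rightarrow> 'b) \<Rightarrow> bool"
where
  "cond_indep_var M L X L' Y N T \<longleftrightarrow>
     (\<forall>A\<in>sets L. \<forall>B\<in>sets L'. AE \<omega> in M.
        prob_given M T N ((X -` A \<inter> space M) \<inter> (Y -` B \<inter> space M)) \<omega> =
        prob_given M T N (X -` A \<inter> space M) \<omega> * prob_given M T N (Y -` B \<inter> space M) \<omega>)"

definition common_cond_distr ::
  "(nat \<Rightarrow> 'k::finite obs) measure set \<Rightarrow> (nat \<Rightarrow> 's measure) \<Rightarrow>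
   (nat \<Rightarrow> (nat \<Rightarrow> 'k obs) \<Rightarrow> 's) \<Rightarrow> nat \<Rightarrow> ('s \<Rightarrow> (nat \<Rightarrow> 'k obs) measure) \<Rightarrow> bool"
where
  "common_cond_distr \<P> \<Sigma> S n \<kappa> \<longleftrightarrow>
     (\<forall>P\<in>\<P>. regular_cond_distr P (\<lambda>\<omega>. restrict \<omega> {1..n}) (obs_fin n)
                (\<lambda>\<omega>. S n (restrict \<omega> {1..n})) (\<Sigma> n) \<kappa>)"

definition sufficient ::
  "(nat \<Rightarrow> 'k::finite obs) measure set \<Rightarrow> (nat \<Rightarrow> 's measure) \<Rightarrow>
   (nat \<Rightarrow> (nat \<Rightarrow> 'k obs) \<Rightarrow> 's) \<Rightarrow> nat \<Rightarrow> bool"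
where
  "sufficient \<P> \<Sigma> S n \<longleftrightarrow> (\<exists>\<kappa>. common_cond_distr \<P> \<Sigma> S n \<kappa>)"

definition totally_sufficient ::
  "(nat \<Rightarrow> 'k::finite obs) measure set \<Rightarrow> (nat \<Rightarrow> 's measure) \<Rightarrow>
   (nat \<Rightarrow> (nat \<Rightarrow> 'k obs) \<Rightarrow> 's) \<Rightarrow> bool"
where
  "totally_sufficient \<P> \<Sigma> S \<longleftrightarrow>
     (\<forall>n\<ge>1. sufficient \<P> \<Sigma> S n \<and>
        (\<forall>P\<in>\<P>. cond_indep_var P (obs_fin n) (\<lambda>\<omega>. restrict \<omega> {1..n})
                   (PiM {n + 1..} (\<lambda>_. borel)) (\<lambda>\<omega>. restrict \<omega> {n + 1..})
                   (\<Sigma> n) (\<lambda>\<omega>. S n (restrict \<omega> {1..n}))))"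

definition ATTS ::
  "(nat \<Rightarrow> 'k::finite obs) measure set \<Rightarrow> (nat \<Rightarrow> 's measure) \<Rightarrow>
   (nat \<Rightarrow> (nat \<Rightarrow> 'k obs) \<Rightarrow> 's) \<Rightarrow> bool"
where
  "ATTS \<P> \<Sigma> S \<longleftrightarrow>
     statistics \<Sigma> S \<and> algebraically_transitive \<Sigma> S \<and> totally_sufficient \<P> \<Sigma> S"

definition nonconformity_measure ::
  "(nat \<Rightarrow> 's measure) \<Rightarrow> (nat \<Rightarrow> 's \<times> 'k::finite obs \<Rightarrow> real) \<Rightarrow> bool" where
  "nonconformity_measure \<Sigma> A \<longleftrightarrow> (\<forall>n\<ge>1. A n \<in> borel_measurable (\<Sigma> (n - 1) \<Otimes>\<^sub>M borel))"

definition score ::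
  "(nat \<Rightarrow> (nat \<Rightarrow> 'k::finite obs) \<Rightarrow> 's) \<Rightarrow> (nat \<Rightarrow> 's \<times> 'k obs \<Rightarrow> real) \<Rightarrow>
   nat \<Rightarrow> (nat \<Rightarrow> 'k obs) \<Rightarrow> real"
where
  "score S A n z = A n (S (n - 1) (restrict z {1..n - 1}), z n)"

text \<open>
  The conditional probabilities given \<open>S\<^sub>n = s\<close> are evaluated with the chosen version \<open>\<kappa> n s\<close> of
  the common regular conditional distribution of the first \<open>n\<close> observations.
\<close>

definition p_value ::
  "(nat \<Rightarrow> (nat \<Rightarrow> 'k::finite obs) \<Rightarrow> 's) \<Rightarrow> (nat \<Rightarrow> 's \<Rightarrow> (nat \<Rightarrow> 'k obs) measure) \<Rightarrow>
   (nat \<Rightarrow> 's \<times> 'k obs \<Rightarrow> real) \<Rightarrow> nat \<Rightarrow> (nat \<Rightarrow> 'k obs) \<Rightarrow> real \<Rightarrow> real"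
where
  "p_value S \<kappa> A n z t =
     measure (\<kappa> n (S n z)) {\<xi> \<in> space (obs_fin n). score S A n \<xi> > score S A n z} +
     t * measure (\<kappa> n (S n z)) {\<xi> \<in> space (obs_fin n). score S A n \<xi> = score S A n z}"

text \<open>Here \<open>z\<close> is the sequence of the first \<open>n - 1\<close> observations and \<open>x\<close> the new object.\<close>

definition prediction_region ::
  "(nat \<Rightarrow> (nat \<Rightarrow> 'k::finite obs) \<Rightarrow> 's) \<Rightarrow> (nat \<Rightarrow> 's \<Rightarrow> (nat \<Rightarrow> 'k obs) measure) \<Rightarrow>
   (nat \<Rightarrow> 's \<times> 'k obs \<Rightarrow> real) \<Rightarrow> real \<Rightarrow> nat \<Rightarrow> (nat \<Rightarrow> 'k obs) \<Rightarrow> real ^ 'k \<Rightarrow> real \<Rightarrow> real set"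
where
  "prediction_region S \<kappa> A \<epsilon> n z x t = {y. p_value S \<kappa> A n (z(n := (x, y))) t > \<epsilon>}"

definition err ::
  "(nat \<Rightarrow> (nat \<Rightarrow> 'k::finite obs) \<Rightarrow> 's) \<Rightarrow> (nat \<Rightarrow> 's \<Rightarrow> (nat \<Rightarrow> 'k obs) measure) \<Rightarrow>
   (nat \<Rightarrow> 's \<times> 'k obs \<Rightarrow> real) \<Rightarrow> real \<Rightarrow> nat \<Rightarrow> (nat \<Rightarrow> 'k obs) \<Rightarrow> (nat \<Rightarrow> real) \<Rightarrow> nat"
where
  "err S \<kappa> A \<epsilon> n \<zeta> \<tau> =
     (if snd (\<zeta> n) \<notin> prediction_region S \<kappa> A \<epsilon> n (restrict \<zeta> {1..n - 1}) (fst (\<zeta> n)) (\<tau> n)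
      then 1 else 0)"

end

theory Submission
  imports Defs
begin

text \<open>
  Call the \<^emph>\<open>future\<close> after step \<open>n\<close> the statistic \<open>S\<^sub>n\<close> of the first \<open>n\<close> observations together with
  all later observations and all later random numbers.  Two facts about it give the theorem.

  First, the error at step \<open>n\<close> has probability \<open>\<epsilon>\<close> independently of the future after step \<open>n\<close>
  (lemma \<open>prob_error_given_future\<close>).  By total sufficiency, conditionally on \<open>S\<^sub>n\<close> the first \<open>n\<close>
  observations are distributed according to \<open>\<kappa>\<^sub>n\<close> and do not depend on the later ones
  (\<open>cond_indep_disintegration\<close>).  The \<open>p\<close>-value is computed from that same distribution \<open>\<kappa>\<^sub>n\<close>, so
  conditionally it is the randomised tail probability of a real random variable under its own law,
  and such a tail probability is uniform on \<open>[0,1]\<close> (\<open>smoothed_p_uniform\<close>): smoothing by the independent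
  \<open>\<tau>\<^sub>n\<close> fills exactly the jumps left by atoms.

  Second, the future after step \<open>n\<close> determines all later errors (\<open>error_measurable_earlier\<close>).
  By algebraic transitivity \<open>S\<^sub>n\<^sub>+\<^sub>1\<close> is computed from \<open>S\<^sub>n\<close> and the next observation, and so is the
  next score.

  Hence each error is independent of the collection of all errors at later steps.  Read from the
  last step backwards, this factorises all joint probabilities
  (\<open>indep_vars_if_backward_indep\<close>).
\<close>

section \<open>Independence from a decreasing family of algebras\<close>

text \<open>
  Among finitely many indices let \<open>b\<close> be the smallest.  All the other variables are measurable with
  respect to \<open>G b\<close>, hence jointly independent of \<open>e b\<close>.  Splitting off \<open>b\<close> and repeating
  factorises the probability of the intersection.
\<close>

lemma (in prob_space) indep_vars_if_backward_indep:
  fixes G :: "nat \<Rightarrow> 'a measure"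
  assumes rv: "\<And>n. n \<in> I \<Longrightarrow> random_variable (N n) (e n)"
    and space_G: "\<And>m. m \<in> I \<Longrightarrow> space (G m) = space M"
    and meas_G: "\<And>m n. m \<in> I \<Longrightarrow> n \<in> I \<Longrightarrow> m < n \<Longrightarrow> e n \<in> G m \<rightarrow>\<^sub>M N n"
    and indep_G: "\<And>n B H. n \<in> I \<Longrightarrow> B \<in> sets (N n) \<Longrightarrow> H \<in> sets (G n) \<Longrightarrow>
      prob (e n -` B \<inter> space M \<inter> H) = prob (e n -` B \<inter> space M) * prob H"
  shows "indep_vars N e I"
  unfolding indep_vars_def2
proof (intro conjI ballI rv indep_setsI)
  fix n assume n: "n \<in> I" 
  show "{e n -` A \<inter> space M |A. A \<in> sets (N n)} \<subseteq> events"
    using rv[OF n] by (auto intro: measurable_sets)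
next
  fix A J
  assume J: "J \<noteq> {}" "J \<subseteq> I" "finite J" and A: "\<forall>j\<in>J. A j \<in> {e j -` A \<inter> space M |A. A \<in> sets (N j)}"
  from J(3,1,2) A show "prob (\<Inter>j\<in>J. A j) = (\<Prod>j\<in>J. prob (A j))"
  proof (induction J rule: finite_linorder_min_induct)
    case (insert b J)
    obtain B where B: "A b = e b -` B \<inter> space M" "B \<in> sets (N b)"
      using insert.prems by auto
    show ?case
    proof (cases "J = {}")
      case False
      have "A j \<in> sets (G b)" if "j \<in> J" for j
      proof -
        obtain C where C: "A j = e j -` C \<inter> space M" "C \<in> sets (N j)"
          using insert.prems \<open>j \<in> J\<close> by auto
        have "e j \<in> G b \<rightarrow>\<^sub>M N j"
          using insert.prems insert.hyps \<open>j \<in> J\<close> by (intro meas_G) auto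
        then have "e j -` C \<inter> space (G b) \<in> sets (G b)"
          by (rule measurable_sets) (rule C(2))
        then show ?thesis
          using C(1) space_G[of b] insert.prems by simp
      qed
      then have "(\<Inter>j\<in>J. A j) \<in> sets (G b)"
        using False insert.hyps by (intro sets.finite_INT) auto
      then have "prob (A b \<inter> (\<Inter>j\<in>J. A j)) = prob (A b) * prob (\<Inter>j\<in>J. A j)"
        using indep_G[of b B] B insert.prems by simp
      also have "prob (\<Inter>j\<in>J. A j) = (\<Prod>j\<in>J. prob (A j))"
        using insert False by auto
      finally show ?thesis
        using insert.hyps by (subst prod.insert) auto
    qed (use insert in simp)
  qed simp
qed

section \<open>Disintegration along a sufficient statistic\<close>

lemma measure_eqI_rectangles:
  assumes "finite_measure \<mu>" "sets \<mu> = sets (A \<Otimes>\<^sub>M B)" "sets \<nu> = sets (A \<Otimes>\<^sub>M B)"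
    and eq: "\<And>a b. a \<in> sets A \<Longrightarrow> b \<in> sets B \<Longrightarrow> emeasure \<mu> (a \<times> b) = emeasure \<nu> (a \<times> b)"
  shows "\<mu> = \<nu>"
proof (rule measure_eqI_generator_eq[OF Int_stable_pair_measure_generator[of A B] pair_measure_closed])
  show "range (\<lambda>_. space A \<times> space B) \<subseteq> {a \<times> b |a b. a \<in> sets A \<and> b \<in> sets B}"
    by auto
  show "emeasure \<mu> (space A \<times> space B) \<noteq> \<infinity>"
    using assms(1) by (simp add: finite_measure.emeasure_finite)
qed (use assms in \<open>auto simp: sets_pair_measure\<close>)

text \<open>
  Given \<open>T\<close>, the variable \<open>X\<close> may be resampled from \<open>\<kappa>\<close> without changing the joint law of
  \<open>(X, T, Y)\<close>.  On a box this is conditional independence followed by pulling the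
  \<open>T\<close>-measurable factor \<open>\<kappa> (T \<omega>) a\<close> out of a conditional expectation; uniqueness of measures gives
  the general case.  The value \<open>T \<omega>\<close> is an argument of \<open>f\<close> in its own right and is not recomputed
  from the resampled \<open>x\<close>: for a general \<open>\<sigma>\<close>-algebra \<open>N\<close> the measure \<open>\<kappa> s\<close> may fail to be
  concentrated on the fibre \<open>T = s\<close>.
\<close>

lemma cond_indep_disintegration:
  assumes "prob_space M"
    and X[measurable]: "X \<in> M \<rightarrow>\<^sub>M L" and Y[measurable]: "Y \<in> M \<rightarrow>\<^sub>M L'" and T[measurable]: "T \<in> M \<rightarrow>\<^sub>M N"
    and rcd: "regular_cond_distr M X L T N \<kappa>" and ci: "cond_indep_var M L X L' Y N T"
    and f: "f \<in> borel_measurable (L \<Otimes>\<^sub>M (N \<Otimes>\<^sub>M L'))"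
  shows "(\<integral>\<^sup>+\<omega>. f (X \<omega>, T \<omega>, Y \<omega>) \<partial>M) = (\<integral>\<^sup>+\<omega>. \<integral>\<^sup>+x. f (x, T \<omega>, Y \<omega>) \<partial>\<kappa> (T \<omega>) \<partial>M)"
proof -
  interpret prob_space M by fact
  define F where "F = vimage_algebra (space M) T N"
  have TN: "T \<in> space M \<rightarrow> space N"
    using measurable_space[OF T] by auto
  have TF[measurable]: "T \<in> F \<rightarrow>\<^sub>M N"
    unfolding F_def by (rule measurable_vimage_algebra1[OF TN])
  have "subalgebra M F"
    using sets_image_in_sets[OF refl T] by (simp add: subalgebra_def F_def)
  then interpret F: sigma_finite_subalgebra M F
    by (intro finite_measure_subalgebra_is_sigma_finite) (simp add: finite_measure_subalgebra_def finite_measure_axioms finite_measure_subalgebra_axioms_def)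
  have \<kappa>[measurable]: "\<kappa> \<in> N \<rightarrow>\<^sub>M prob_algebra L"
    and \<kappa>_eq: "\<And>a. a \<in> sets L \<Longrightarrow> AE \<omega> in M. measure (\<kappa> (T \<omega>)) a = prob_given M T N (X -` a \<inter> space M) \<omega>"
    using rcd by (auto simp: regular_cond_distr_def)
  have \<kappa>_space: "prob_space (\<kappa> s)" "sets (\<kappa> s) = sets L" if "s \<in> space N" for s
    using measurable_space[OF \<kappa> that] by (auto simp: space_prob_algebra)
  define K where "K v = distr (\<kappa> (fst v)) (L \<Otimes>\<^sub>M (N \<Otimes>\<^sub>M L')) (\<lambda>x. (x, v))" for v
  have K: "K \<in> N \<Otimes>\<^sub>M L' \<rightarrow>\<^sub>M prob_algebra (L \<Otimes>\<^sub>M (N \<Otimes>\<^sub>M L'))"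
    unfolding K_def by measurable
  have "(\<lambda>\<omega>. K (T \<omega>, Y \<omega>)) \<in> M \<rightarrow>\<^sub>M prob_algebra (L \<Otimes>\<^sub>M (N \<Otimes>\<^sub>M L'))"
    using K by measurable
  note K' = measurable_prob_algebraD[OF this]
  \<comment> \<open>The identity on boxes, the only place where the two conditional hypotheses enter.\<close>
  have key: "prob (X -` a \<inter> T -` b \<inter> Y -` c \<inter> space M) =
      (\<integral>\<omega>. indicator b (T \<omega>) * measure (\<kappa> (T \<omega>)) a * indicator c (Y \<omega>) \<partial>M)"
    if [measurable]: "a \<in> sets L" "b \<in> sets N" "c \<in> sets L'" for a b c
  proof -
    let ?XY = "X -` a \<inter> space M \<inter> (Y -` c \<inter> space M)"
    have int: "integrable M (\<lambda>\<omega>. indicator b (T \<omega>) * indicator ?XY \<omega> :: real)"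
      by (rule integrable_const_bound[where B=1]) (auto simp: indicator_def)
    have m\<kappa>[measurable]: "(\<lambda>\<omega>. measure (\<kappa> (T \<omega>)) a) \<in> borel_measurable F"
      by measurable
    have m\<kappa>'[measurable]: "(\<lambda>\<omega>. measure (\<kappa> (T \<omega>)) a) \<in> borel_measurable M"
      by measurable
    have int2: "integrable M (\<lambda>\<omega>. indicator b (T \<omega>) * measure (\<kappa> (T \<omega>)) a * indicator (Y -` c \<inter> space M) \<omega> :: real)"
      using \<kappa>_space measurable_space[OF T]
      by (intro integrable_const_bound[where B=1])
        (auto simp: indicator_def prob_space.prob_le_1)
    have "prob (X -` a \<inter> T -` b \<inter> Y -` c \<inter> space M) = (\<integral>\<omega>. indicator (X -` a \<inter> T -` b \<inter> Y -` c \<inter> space M) \<omega> \<partial>M)"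
      by simp
    also have "\<dots> = (\<integral>\<omega>. indicator b (T \<omega>) * indicator ?XY \<omega> \<partial>M)"
      by (intro Bochner_Integration.integral_cong) (auto simp: indicator_def)
    also have "\<dots> = (\<integral>\<omega>. indicator b (T \<omega>) * prob_given M T N ?XY \<omega> \<partial>M)"
      unfolding prob_given_def F_def[symmetric]
      by (rule F.real_cond_exp_intg(2)[symmetric, OF int]) measurable
    also have "\<dots> = (\<integral>\<omega>. indicator b (T \<omega>) * measure (\<kappa> (T \<omega>)) a * prob_given M T N (Y -` c \<inter> space M) \<omega> \<partial>M)"
    proof (rule integral_cong_AE)
      show "AE \<omega> in M. indicator b (T \<omega>) * prob_given M T N ?XY \<omega> =
           indicator b (T \<omega>) * measure (\<kappa> (T \<omega>)) a * prob_given M T N (Y -` c \<inter> space M) \<omega>"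
        using \<kappa>_eq[OF that(1)] ci[unfolded cond_indep_var_def, rule_format, OF that(1,3)]
        by eventually_elim simp
    qed (simp_all add: prob_given_def)
    also have "\<dots> = (\<integral>\<omega>. indicator b (T \<omega>) * measure (\<kappa> (T \<omega>)) a * indicator (Y -` c \<inter> space M) \<omega> \<partial>M)"
      unfolding prob_given_def F_def[symmetric]
      by (rule F.real_cond_exp_intg(2)[OF int2]) measurable
    also have "\<dots> = (\<integral>\<omega>. indicator b (T \<omega>) * measure (\<kappa> (T \<omega>)) a * indicator c (Y \<omega>) \<partial>M)"
      by (intro Bochner_Integration.integral_cong) (auto simp: indicator_def)
    finally show ?thesis .
  qed
  have eK: "emeasure (K (T \<omega>, Y \<omega>)) (a \<times> d) = indicator d (T \<omega>, Y \<omega>) * emeasure (\<kappa> (T \<omega>)) a"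
    if "\<omega> \<in> space M" and [measurable]: "a \<in> sets L" "d \<in> sets (N \<Otimes>\<^sub>M L')" for \<omega> a d
  proof -
    have s: "sets (\<kappa> (T \<omega>)) = sets L" "(T \<omega>, Y \<omega>) \<in> space (N \<Otimes>\<^sub>M L')"
      using \<kappa>_space measurable_space[OF T that(1)] measurable_space[OF Y that(1)] by (auto simp: space_pair_measure)
    have "(\<lambda>x. (x, T \<omega>, Y \<omega>)) -` (a \<times> d) \<inter> space (\<kappa> (T \<omega>)) = (if (T \<omega>, Y \<omega>) \<in> d then a else {})"
      using sets.sets_into_space[of a "\<kappa> (T \<omega>)"] s by auto
    moreover have "(\<lambda>x. (x, T \<omega>, Y \<omega>)) \<in> \<kappa> (T \<omega>) \<rightarrow>\<^sub>M L \<Otimes>\<^sub>M (N \<Otimes>\<^sub>M L')"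
      using s by (simp cong: measurable_cong_sets)
    ultimately show ?thesis
      by (simp add: K_def emeasure_distr indicator_def)
  qed
  have "distr M (L \<Otimes>\<^sub>M (N \<Otimes>\<^sub>M L')) (\<lambda>\<omega>. (X \<omega>, T \<omega>, Y \<omega>)) = M \<bind> (\<lambda>\<omega>. K (T \<omega>, Y \<omega>))"
  proof (rule measure_eqI_rectangles)
    show "finite_measure (distr M (L \<Otimes>\<^sub>M (N \<Otimes>\<^sub>M L')) (\<lambda>\<omega>. (X \<omega>, T \<omega>, Y \<omega>)))"
      by (intro finite_measure_distr) measurable
    show "sets (M \<bind> (\<lambda>\<omega>. K (T \<omega>, Y \<omega>))) = sets (L \<Otimes>\<^sub>M (N \<Otimes>\<^sub>M L'))"
      using K' not_empty by (intro sets_bind) (auto dest: sets_kernel)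
    fix a d assume a[measurable]: "a \<in> sets L" and d[measurable]: "d \<in> sets (N \<Otimes>\<^sub>M L')"
    \<comment> \<open>With \<open>a\<close> fixed, both sides are measures in \<open>d\<close>, so it suffices to compare them on
      rectangles \<open>b \<times> c\<close>.\<close>
    define \<mu>a where "\<mu>a = distr (density M (indicator (X -` a \<inter> space M))) (N \<Otimes>\<^sub>M L') (\<lambda>\<omega>. (T \<omega>, Y \<omega>))"
    define \<nu>a where "\<nu>a = distr (density M (\<lambda>\<omega>. emeasure (\<kappa> (T \<omega>)) a)) (N \<Otimes>\<^sub>M L') (\<lambda>\<omega>. (T \<omega>, Y \<omega>))"
    have m\<kappa>[measurable]: "(\<lambda>\<omega>. emeasure (\<kappa> (T \<omega>)) a) \<in> borel_measurable M"
      using measurable_prob_algebraD[OF \<kappa>] by measurable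
    have \<mu>a: "emeasure \<mu>a d = emeasure M {\<omega>\<in>space M. X \<omega> \<in> a \<and> (T \<omega>, Y \<omega>) \<in> d}"
      if [measurable]: "d \<in> sets (N \<Otimes>\<^sub>M L')" for d
    proof -
      have "emeasure \<mu>a d = (\<integral>\<^sup>+\<omega>. indicator (X -` a \<inter> space M) \<omega> * indicator ((\<lambda>\<omega>. (T \<omega>, Y \<omega>)) -` d \<inter> space M) \<omega> \<partial>M)"
        by (simp add: \<mu>a_def emeasure_distr emeasure_density)
      also have "\<dots> = (\<integral>\<^sup>+\<omega>. indicator {\<omega>\<in>space M. X \<omega> \<in> a \<and> (T \<omega>, Y \<omega>) \<in> d} \<omega> \<partial>M)"
        by (intro nn_integral_cong) (auto simp: indicator_def)
      finally show ?thesis by simp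
    qed
    have \<nu>a: "emeasure \<nu>a d = (\<integral>\<^sup>+\<omega>. indicator d (T \<omega>, Y \<omega>) * emeasure (\<kappa> (T \<omega>)) a \<partial>M)"
      if [measurable]: "d \<in> sets (N \<Otimes>\<^sub>M L')" for d
      by (auto simp add: \<nu>a_def emeasure_distr emeasure_density intro!: nn_integral_cong split: split_indicator)
    have "\<mu>a = \<nu>a"
    proof (rule measure_eqI_rectangles)
      show "finite_measure \<mu>a"
      proof
        show "emeasure \<mu>a (space \<mu>a) \<noteq> \<infinity>"
          using \<mu>a[of "space (N \<Otimes>\<^sub>M L')"] by (simp add: \<mu>a_def)
      qed
      fix b c assume [measurable]: "b \<in> sets N" "c \<in> sets L'"
      have "emeasure \<mu>a (b \<times> c) = emeasure M (X -` a \<inter> T -` b \<inter> Y -` c \<inter> space M)"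
        by (auto simp: \<mu>a intro!: arg_cong[where f="emeasure M"])
      also have "\<dots> = ennreal (\<integral>\<omega>. indicator b (T \<omega>) * measure (\<kappa> (T \<omega>)) a * indicator c (Y \<omega>) \<partial>M)"
        by (simp add: emeasure_eq_measure key)
      also have "\<dots> = (\<integral>\<^sup>+\<omega>. ennreal (indicator b (T \<omega>) * measure (\<kappa> (T \<omega>)) a * indicator c (Y \<omega>)) \<partial>M)"
      proof (rule nn_integral_eq_integral[symmetric])
        show "integrable M (\<lambda>\<omega>. indicator b (T \<omega>) * measure (\<kappa> (T \<omega>)) a * indicator c (Y \<omega>) :: real)"
          using \<kappa>_space measurable_space[OF T]
          by (intro integrable_const_bound[where B=1])
            (auto simp: indicator_def prob_space.prob_le_1)
      qed simp
      also have "\<dots> = emeasure \<nu>a (b \<times> c)"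
      proof -
        have "emeasure (\<kappa> (T \<omega>)) a = ennreal (measure (\<kappa> (T \<omega>)) a)" if "\<omega> \<in> space M" for \<omega>
          using \<kappa>_space measurable_space[OF T that] by (intro finite_measure.emeasure_eq_measure) (auto simp: prob_space_def)
        then show ?thesis
          by (auto simp add: \<nu>a intro!: nn_integral_cong split: split_indicator)
      qed
      finally show "emeasure \<mu>a (b \<times> c) = emeasure \<nu>a (b \<times> c)" .
    qed (simp_all add: \<mu>a_def \<nu>a_def)
    have "emeasure (distr M (L \<Otimes>\<^sub>M (N \<Otimes>\<^sub>M L')) (\<lambda>\<omega>. (X \<omega>, T \<omega>, Y \<omega>))) (a \<times> d) = emeasure \<mu>a d"
      by (auto simp: emeasure_distr \<mu>a[OF d] intro!: arg_cong[where f="emeasure M"])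
    also have "\<dots> = (\<integral>\<^sup>+\<omega>. emeasure (K (T \<omega>, Y \<omega>)) (a \<times> d) \<partial>M)"
      using \<open>\<mu>a = \<nu>a\<close> \<nu>a[OF d] by (simp add: eK cong: nn_integral_cong)
    also have "\<dots> = emeasure (M \<bind> (\<lambda>\<omega>. K (T \<omega>, Y \<omega>))) (a \<times> d)"
      using not_empty by (intro emeasure_bind[symmetric, OF _ K']) auto
    finally show "emeasure (distr M (L \<Otimes>\<^sub>M (N \<Otimes>\<^sub>M L')) (\<lambda>\<omega>. (X \<omega>, T \<omega>, Y \<omega>))) (a \<times> d) =
      emeasure (M \<bind> (\<lambda>\<omega>. K (T \<omega>, Y \<omega>))) (a \<times> d)" .
  qed simp
  then have "(\<integral>\<^sup>+\<omega>. f (X \<omega>, T \<omega>, Y \<omega>) \<partial>M) = (\<integral>\<^sup>+w. f w \<partial>(M \<bind> (\<lambda>\<omega>. K (T \<omega>, Y \<omega>))))"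
    using f by (subst nn_integral_distr[symmetric, where f=f]) auto
  also have "\<dots> = (\<integral>\<^sup>+\<omega>. \<integral>\<^sup>+w. f w \<partial>K (T \<omega>, Y \<omega>) \<partial>M)"
    by (rule nn_integral_bind[OF f K'])
  also have "\<dots> = (\<integral>\<^sup>+\<omega>. \<integral>\<^sup>+x. f (x, T \<omega>, Y \<omega>) \<partial>\<kappa> (T \<omega>) \<partial>M)"
  proof (intro nn_integral_cong)
    fix \<omega> assume "\<omega> \<in> space M"
    then have s: "sets (\<kappa> (T \<omega>)) = sets L" "(T \<omega>, Y \<omega>) \<in> space (N \<Otimes>\<^sub>M L')"
      using \<kappa>_space measurable_space[OF T] measurable_space[OF Y] by (auto simp: space_pair_measure)
    then have "(\<lambda>x. (x, T \<omega>, Y \<omega>)) \<in> \<kappa> (T \<omega>) \<rightarrow>\<^sub>M L \<Otimes>\<^sub>M (N \<Otimes>\<^sub>M L')"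
      by (simp cong: measurable_cong_sets)
    then show "(\<integral>\<^sup>+w. f w \<partial>K (T \<omega>, Y \<omega>)) = (\<integral>\<^sup>+x. f (x, T \<omega>, Y \<omega>) \<partial>\<kappa> (T \<omega>))"
      using f by (simp add: K_def nn_integral_distr)
  qed
  finally show ?thesis .
qed

section \<open>Uniformity of smoothed tail probabilities\<close>

abbreviation unif :: "real measure" where
  "unif \<equiv> uniform_measure lborel {0..1::real}"

lemma prob_space_unif: "prob_space unif"
  by (rule prob_space_uniform_measure) auto

text \<open>
  The \<open>p\<close>-value at observed score \<open>a\<close> and random number \<open>t\<close> when the score \<open>f\<close> is taken under the
  null distribution \<open>Q\<close>.  Keeping \<open>Q\<close> and \<open>a\<close> as separate arguments makes it possible to hold the
  conditional distribution fixed while the observations are resampled.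
\<close>

definition smoothed_p :: "'a measure \<Rightarrow> ('a \<Rightarrow> real) \<Rightarrow> real \<Rightarrow> real \<Rightarrow> real" where
  "smoothed_p Q f a t =
     measure Q {x \<in> space Q. f x > a} + t * measure Q {x \<in> space Q. f x = a}"

lemma measurable_smoothed_p:
  assumes \<kappa>[measurable]: "\<kappa> \<in> K \<rightarrow>\<^sub>M prob_algebra L" and f[measurable]: "f \<in> borel_measurable L"
    and [measurable]: "a \<in> borel_measurable K" "t \<in> borel_measurable K"
  shows "(\<lambda>w. smoothed_p (\<kappa> w) f (a w) (t w)) \<in> borel_measurable K"
proof -
  have space_\<kappa>: "space (\<kappa> w) = space L" if "w \<in> space K" for w
    using measurable_space[OF \<kappa> that] by (auto simp: space_prob_algebra dest: sets_eq_imp_space_eq)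
  have "(\<lambda>w. measure (\<kappa> w) {x\<in>space L. a w < f x}) \<in> borel_measurable K"
    "(\<lambda>w. measure (\<kappa> w) {x\<in>space L. f x = a w}) \<in> borel_measurable K"
    by (rule measure_measurable_prob_algebra2[OF _ \<kappa>], subst SIGMA_Collect_eq, measurable)+
  then have "(\<lambda>w. measure (\<kappa> w) {x\<in>space L. a w < f x} + t w * measure (\<kappa> w) {x\<in>space L. f x = a w})
      \<in> borel_measurable K"
    by measurable
  then show ?thesis
    by (rule measurable_cong[THEN iffD1, rotated]) (simp add: smoothed_p_def space_\<kappa>)
qed

lemma (in real_distribution) quantile_exists:
  assumes "0 < p" "p < 1"
  obtains q where "p \<le> cdf M q" "measure M {..<q} \<le> p" "\<And>x. x < q \<Longrightarrow> cdf M x < p"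
proof -
  let ?A = "{x. p \<le> cdf M x}"
  have "eventually (\<lambda>x. p < cdf M x) at_top"
    using cdf_lim_at_top_prob assms by (auto dest: order_tendstoD)
  then have ne: "?A \<noteq> {}"
    using eventually_happens'[OF trivial_limit_at_top_linorder] by (auto dest: less_imp_le)
  have bdd: "bdd_below ?A"
  proof -
    have "eventually (\<lambda>x. cdf M x < p) at_bot"
      using cdf_lim_at_bot assms by (auto dest: order_tendstoD)
    then obtain b where b: "\<And>x. x \<le> b \<Longrightarrow> cdf M x < p"
      unfolding eventually_at_bot_linorder by blast
    show ?thesis
      proof (rule bdd_belowI[of _ b])
      fix x assume "x \<in> ?A"
      then show "b \<le> x" using b[of x] by (cases "x \<le> b") auto
    qed
  qed
  have above: "p \<le> cdf M x" if "Inf ?A < x" for x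
  proof -
    obtain y where "p \<le> cdf M y" "y < x"
      using cInf_less_iff[OF ne bdd, of x] \<open>Inf ?A < x\<close> by blast
    then show ?thesis
      using cdf_nondecreasing[of y x] by simp
  qed
  have below: "cdf M x < p" if "x < Inf ?A" for x
    using that cInf_lower[OF _ bdd, of x] by (cases "p \<le> cdf M x") auto
  show ?thesis
  proof (rule that[OF _ _ below])
    have "(cdf M \<longlongrightarrow> cdf M (Inf ?A)) (at_right (Inf ?A))"
      using cdf_is_right_cont by (simp add: continuous_within)
    then show "p \<le> cdf M (Inf ?A)"
      by (rule tendsto_lowerbound) (auto simp: eventually_at_filter intro!: always_eventually above)
    show "measure M {..<Inf ?A} \<le> p"
      by (rule tendsto_upperbound[OF cdf_at_left])
        (auto simp: eventually_at_filter intro!: always_eventually less_imp_le below)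
  qed
qed

lemma emeasure_uniform_atMost:
  assumes "0 \<le> r" "r \<le> 1"
  shows "emeasure unif {..r} = ennreal r"
proof -
  have "{0..1} \<inter> {..r} = {0..r}" using assms by auto
  then show ?thesis using assms by (simp add: emeasure_uniform_measure divide_ennreal_def)
qed

text \<open>
  Let \<open>q\<close> be a \<open>(1 - \<epsilon>)\<close>-quantile.  Points above \<open>q\<close> have \<open>p\<close>-value at most \<open>\<epsilon>\<close> for every random
  number and points below \<open>q\<close> for none.  At \<open>q\<close> itself the random number decides, and it does so
  with exactly the probability that brings the total up to \<open>\<epsilon>\<close>.
\<close>

lemma (in real_distribution) smoothed_tail_uniform:
  assumes "0 < \<epsilon>" "\<epsilon> < 1"
  shows "(\<integral>\<^sup>+a. emeasure unif
      {t. measure M {a<..} + t * measure M {a} \<le> \<epsilon>} \<partial>M) = ennreal \<epsilon>"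
proof -
  let ?U = "unif"
  interpret U: prob_space ?U by (rule prob_space_unif)
  obtain q where q: "1 - \<epsilon> \<le> cdf M q" "measure M {..<q} \<le> 1 - \<epsilon>" "\<And>x. x < q \<Longrightarrow> cdf M x < 1 - \<epsilon>"
    using quantile_exists[of "1 - \<epsilon>"] assms by auto
  have gt: "measure M {a<..} = 1 - cdf M a" for a
    using prob_compl[of "{..a}"] by (simp add: cdf_def Compl_eq_Diff_UNIV[symmetric])
  have ge: "measure M {a<..} + measure M {a} = 1 - measure M {..<a}" for a
  proof -
    have "measure M {a<..} + measure M {a} = measure M ({a<..} \<union> {a})"
      by (intro finite_measure_Union[symmetric]) auto
    also have "{a<..} \<union> {a} = - {..<a}" by auto
    finally show ?thesis
      using prob_compl[of "{..<a}"] by (simp add: Compl_eq_Diff_UNIV[symmetric])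
  qed
  \<comment> \<open>The part of the level \<open>\<epsilon>\<close> that the atom at \<open>q\<close> has to supply.\<close>
  define c where "c = \<epsilon> - measure M {q<..}"
  have c: "0 \<le> c" "c \<le> measure M {q}"
    using q ge[of q] gt[of q] by (auto simp: c_def)
  let ?g = "\<lambda>a. emeasure ?U {t. measure M {a<..} + t * measure M {a} \<le> \<epsilon>}"
  have restrict: "?g a = emeasure ?U {t\<in>{0..1}. measure M {a<..} + t * measure M {a} \<le> \<epsilon>}" for a
    by (subst (1 2) emeasure_uniform_measure) (auto intro!: arg_cong2[where f="(/)"] arg_cong[where f="emeasure lborel"])
  have right: "?g a = 1" if "q < a" for a
  proof -
    have "measure M {..<a} \<ge> 1 - \<epsilon>"
      using q(1) that by (auto simp: cdf_def intro: order_trans[OF _ finite_measure_mono])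
    then have "measure M {a<..} + t * measure M {a} \<le> \<epsilon>" if "t \<in> {0..1}" for t
      using ge[of a] that mult_right_mono[of t 1 "measure M {a}"] by auto
    then have *: "{t\<in>{0..1}. measure M {a<..} + t * measure M {a} \<le> \<epsilon>} = {0..1}" by auto
    show ?thesis
      unfolding restrict * by (simp add: emeasure_uniform_measure)
  qed
  have left: "?g a = 0" if "a < q" for a
  proof -
    have "measure M {a<..} + t * measure M {a} > \<epsilon>" if "t \<in> {0..1}" for t
    proof -
      have "0 \<le> t * measure M {a}" using that by simp
      then show ?thesis using q(3)[OF \<open>a < q\<close>] gt[of a] by linarith
    qed
    then have *: "{t\<in>{0..1}. measure M {a<..} + t * measure M {a} \<le> \<epsilon>} = {}"
      by (intro Collect_empty_eq[THEN iffD2] allI notI) (meson leD)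
    show ?thesis
      unfolding restrict * by simp
  qed
  have mid: "?g q * emeasure M {q} = ennreal c"
  proof (cases "measure M {q} = 0")
    case False
    then have m: "measure M {q} > 0"
      using zero_less_measure_iff by blast
    then have "{t. measure M {q<..} + t * measure M {q} \<le> \<epsilon>} = {..c / measure M {q}}"
      by (auto simp: c_def field_simps)
    then have "?g q = ennreal (c / measure M {q})"
      using emeasure_uniform_atMost[of "c / measure M {q}"] c m by (simp add: divide_ennreal_def)
    then show ?thesis
      using c m by (simp add: emeasure_eq_measure ennreal_mult[symmetric])
  qed (use c in \<open>simp add: emeasure_eq_measure\<close>)
  have "(\<integral>\<^sup>+a. ?g a \<partial>M) = (\<integral>\<^sup>+a. indicator {q<..} a + ?g q * indicator {q} a \<partial>M)"
    using left right by (intro nn_integral_cong) (auto simp: indicator_def neq_iff)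
  also have "\<dots> = ennreal (measure M {q<..}) + ennreal c"
    by (simp add: nn_integral_add nn_integral_cmult mid emeasure_eq_measure[symmetric] del: emeasure_uniform_measure)
  also have "\<dots> = ennreal \<epsilon>"
    using c(1) by (subst ennreal_plus[symmetric]) (auto simp: c_def)
  finally show ?thesis .
qed

lemma smoothed_p_uniform:
  assumes "prob_space Q" and f[measurable]: "f \<in> borel_measurable Q" and "0 < \<epsilon>" "\<epsilon> < 1"
  shows "(\<integral>\<^sup>+x. emeasure unif {t. smoothed_p Q f (f x) t \<le> \<epsilon>} \<partial>Q) = ennreal \<epsilon>"
proof -
  interpret prob_space Q by fact
  interpret D: real_distribution "distr Q borel f" by simp
  let ?h = "\<lambda>a. emeasure unif
    {t. measure (distr Q borel f) {a<..} + t * measure (distr Q borel f) {a} \<le> \<epsilon>}"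
  have eq: "smoothed_p Q f a t = measure (distr Q borel f) {a<..} + t * measure (distr Q borel f) {a}" for a t
    by (auto simp: smoothed_p_def measure_distr intro!: arg_cong2[where f="(+)"] arg_cong2[where f="(*)"] arg_cong[where f="measure Q"])
  interpret U: prob_space "unif" by (rule prob_space_unif)
  have "Q \<in> space (prob_algebra Q)"
    by (simp add: space_prob_algebra prob_space_axioms)
  then have "(\<lambda>w. smoothed_p Q f (fst w) (snd w)) \<in> borel_measurable (borel \<Otimes>\<^sub>M borel)"
    by (intro measurable_smoothed_p[where L=Q]) auto
  then have "{w \<in> space (borel \<Otimes>\<^sub>M borel). smoothed_p Q f (fst w) (snd w) \<le> \<epsilon>} \<in> sets (borel \<Otimes>\<^sub>M borel)"
    by measurable
  also have "sets (borel \<Otimes>\<^sub>M borel) = sets (borel \<Otimes>\<^sub>M unif)"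
    by (intro sets_pair_measure_cong) auto
  finally have "(\<lambda>a. emeasure unif
      (Pair a -` {w \<in> space (borel \<Otimes>\<^sub>M borel). smoothed_p Q f (fst w) (snd w) \<le> \<epsilon>})) \<in> borel_measurable borel"
    by (rule U.measurable_emeasure_Pair)
  then have h[measurable]: "?h \<in> borel_measurable borel"
    by (simp add: space_pair_measure vimage_def eq)
  have "(\<integral>\<^sup>+x. emeasure unif {t. smoothed_p Q f (f x) t \<le> \<epsilon>} \<partial>Q) = (\<integral>\<^sup>+x. ?h (f x) \<partial>Q)"
    by (simp add: eq)
  also have "\<dots> = (\<integral>\<^sup>+a. ?h a \<partial>distr Q borel f)"
    by (intro nn_integral_distr[symmetric] f) (use h in simp)
  also have "\<dots> = ennreal \<epsilon>"
    using assms by (intro D.smoothed_tail_uniform)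
  finally show ?thesis .
qed

section \<open>The error event in a product space\<close>

text \<open>
  The heart of the matter.  Here \<open>X\<close>, \<open>T\<close> and \<open>Y\<close> stand for the first \<open>n\<close> observations, their
  statistic and the later observations, \<open>unif\<close> for the law of \<open>\<tau>\<^sub>n\<close> and \<open>R\<close> for that of the later
  random numbers.  Integrating out the random numbers turns the probability into the expectation of
  \<open>f1 X T * f2 (T, Y)\<close>.  Resampling \<open>X\<close> from \<open>\<kappa> T\<close> replaces the first factor by the probability
  that a smoothed \<open>p\<close>-value for the fixed distribution \<open>\<kappa> T\<close> is at most \<open>\<epsilon>\<close>, which is \<open>\<epsilon>\<close>
  whatever \<open>T\<close> is.
\<close>

lemma error_event_product:
  assumes "prob_space P"
    and X[measurable]: "X \<in> P \<rightarrow>\<^sub>M L" and Y[measurable]: "Y \<in> P \<rightarrow>\<^sub>M L'" and T[measurable]: "T \<in> P \<rightarrow>\<^sub>M N"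
    and rcd: "regular_cond_distr P X L T N \<kappa>" and ci: "cond_indep_var P L X L' Y N T"
    and g[measurable]: "g \<in> borel_measurable L"
    and R: "prob_space R" and W[measurable]: "W \<in> sets ((N \<Otimes>\<^sub>M L') \<Otimes>\<^sub>M R)"
    and \<epsilon>: "0 < \<epsilon>" "\<epsilon> < 1"
  shows "emeasure (P \<Otimes>\<^sub>M (unif \<Otimes>\<^sub>M R))
      {w \<in> space (P \<Otimes>\<^sub>M (unif \<Otimes>\<^sub>M R)). smoothed_p (\<kappa> (T (fst w))) g (g (X (fst w))) (fst (snd w)) \<le> \<epsilon> \<and>
         ((T (fst w), Y (fst w)), snd (snd w)) \<in> W} =
    ennreal \<epsilon> * emeasure (P \<Otimes>\<^sub>M (unif \<Otimes>\<^sub>M R))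
      {w \<in> space (P \<Otimes>\<^sub>M (unif \<Otimes>\<^sub>M R)). ((T (fst w), Y (fst w)), snd (snd w)) \<in> W}"
    (is "emeasure ?M ?E = _ * emeasure ?M ?H")
proof -
  interpret U: prob_space unif by (rule prob_space_unif)
  interpret R: prob_space R by fact
  interpret P: prob_space P by fact
  interpret UR: pair_prob_space unif R ..
  have \<kappa>[measurable]: "\<kappa> \<in> N \<rightarrow>\<^sub>M prob_algebra L"
    using rcd by (simp add: regular_cond_distr_def)
  have \<kappa>_space: "prob_space (\<kappa> s)" "sets (\<kappa> s) = sets L" if "s \<in> space N" for s
    using measurable_space[OF \<kappa> that] by (auto simp: space_prob_algebra)
  define f1 where "f1 x s = emeasure unif {t. smoothed_p (\<kappa> s) g (g x) t \<le> \<epsilon>}" for x s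
  define f2 where "f2 v = emeasure R (Pair v -` W)" for v
  have f1_meas: "(\<lambda>v. f1 (fst v) (snd v)) \<in> borel_measurable (L \<Otimes>\<^sub>M N)"
  proof -
    let ?K = "(L \<Otimes>\<^sub>M N) \<Otimes>\<^sub>M unif"
    have [measurable]: "(\<lambda>w. smoothed_p (\<kappa> (snd (fst w))) g (g (fst (fst w))) (snd w)) \<in> borel_measurable ?K"
      by (rule measurable_smoothed_p[where L=L]) measurable
    have "{w \<in> space ?K. smoothed_p (\<kappa> (snd (fst w))) g (g (fst (fst w))) (snd w) \<le> \<epsilon>} \<in> sets ?K"
      by measurable
    from U.measurable_emeasure_Pair[OF this] show ?thesis
      by (rule measurable_cong[THEN iffD1, rotated]) (auto simp: f1_def space_pair_measure intro!: arg_cong[where f="emeasure unif"])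
  qed
  have f2_meas: "f2 \<in> borel_measurable (N \<Otimes>\<^sub>M L')"
    unfolding f2_def by (rule R.measurable_emeasure_Pair[OF W])
  have meas_p[measurable]: "(\<lambda>w. smoothed_p (\<kappa> (T (fst w))) g (g (X (fst w))) (fst (snd w))) \<in> borel_measurable ?M"
    by (rule measurable_smoothed_p[where L=L]) measurable
  have E[measurable]: "?E \<in> sets ?M" and H[measurable]: "?H \<in> sets ?M"
    by measurable
  have sliceE: "emeasure (unif \<Otimes>\<^sub>M R) (Pair \<omega> -` ?E) = f1 (X \<omega>) (T \<omega>) * f2 (T \<omega>, Y \<omega>)"
    and sliceH: "emeasure (unif \<Otimes>\<^sub>M R) (Pair \<omega> -` ?H) = f2 (T \<omega>, Y \<omega>)" if \<omega>: "\<omega> \<in> space P" for \<omega>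
  proof -
    have W': "Pair (T \<omega>, Y \<omega>) -` W \<in> sets R"
      by (rule sets_Pair1[OF W])
    have p: "{t. smoothed_p (\<kappa> (T \<omega>)) g (g (X \<omega>)) t \<le> \<epsilon>} \<in> sets unif"
      by (simp add: smoothed_p_def)
    have "Pair \<omega> -` ?E = {t. smoothed_p (\<kappa> (T \<omega>)) g (g (X \<omega>)) t \<le> \<epsilon>} \<times> (Pair (T \<omega>, Y \<omega>) -` W)"
      using \<omega> sets.sets_into_space[OF W'] by (auto simp: space_pair_measure)
    then show "emeasure (unif \<Otimes>\<^sub>M R) (Pair \<omega> -` ?E) = f1 (X \<omega>) (T \<omega>) * f2 (T \<omega>, Y \<omega>)"
      using R.emeasure_pair_measure_Times[OF p W'] by (simp add: f1_def f2_def)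
    have "Pair \<omega> -` ?H = space unif \<times> (Pair (T \<omega>, Y \<omega>) -` W)"
      using \<omega> sets.sets_into_space[OF W'] by (auto simp: space_pair_measure)
    then show "emeasure (unif \<Otimes>\<^sub>M R) (Pair \<omega> -` ?H) = f2 (T \<omega>, Y \<omega>)"
      using R.emeasure_pair_measure_Times[OF sets.top[of unif] W'] U.emeasure_space_1 
      by (simp add: f2_def del: space_uniform_measure)
  qed
  have "emeasure ?M ?E = (\<integral>\<^sup>+\<omega>. f1 (X \<omega>) (T \<omega>) * f2 (T \<omega>, Y \<omega>) \<partial>P)"
    unfolding UR.emeasure_pair_measure_alt[OF E] by (rule nn_integral_cong) (rule sliceE)
  also have "\<dots> = (\<integral>\<^sup>+\<omega>. \<integral>\<^sup>+x. f1 x (T \<omega>) * f2 (T \<omega>, Y \<omega>) \<partial>\<kappa> (T \<omega>) \<partial>P)"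
  proof -
    have "(\<lambda>w. f1 (fst w) (fst (snd w)) * f2 (snd w)) \<in> borel_measurable (L \<Otimes>\<^sub>M (N \<Otimes>\<^sub>M L'))"
      using measurable_compose[OF _ f1_meas, of "\<lambda>(x, s, y). (x, s)" "L \<Otimes>\<^sub>M (N \<Otimes>\<^sub>M L')"]
        measurable_compose[OF _ f2_meas, of "snd" "L \<Otimes>\<^sub>M (N \<Otimes>\<^sub>M L')"]
      by (auto simp: case_prod_beta)
    from cond_indep_disintegration[OF assms(1) X Y T rcd ci this] show ?thesis
      by simp
  qed
  also have "\<dots> = (\<integral>\<^sup>+\<omega>. ennreal \<epsilon> * f2 (T \<omega>, Y \<omega>) \<partial>P)"
  proof (intro nn_integral_cong)
    fix \<omega> assume "\<omega> \<in> space P"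
    then have s: "T \<omega> \<in> space N" by (rule measurable_space[OF T])
    have f1: "(\<lambda>x. f1 x (T \<omega>)) \<in> borel_measurable (\<kappa> (T \<omega>))"
      using measurable_compose[OF measurable_Pair2'[OF s] f1_meas] \<kappa>_space[OF s] by (simp cong: measurable_cong_sets)
    have "(\<integral>\<^sup>+x. f1 x (T \<omega>) \<partial>\<kappa> (T \<omega>)) = ennreal \<epsilon>"
      unfolding f1_def using \<kappa>_space[OF s] g by (intro smoothed_p_uniform \<epsilon>) (auto cong: measurable_cong_sets)
    then show "(\<integral>\<^sup>+x. f1 x (T \<omega>) * f2 (T \<omega>, Y \<omega>) \<partial>\<kappa> (T \<omega>)) = ennreal \<epsilon> * f2 (T \<omega>, Y \<omega>)"
      using f1 by (simp add: nn_integral_multc)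
  qed
  also have "\<dots> = ennreal \<epsilon> * (\<integral>\<^sup>+\<omega>. f2 (T \<omega>, Y \<omega>) \<partial>P)"
    using measurable_compose[OF _ f2_meas, of "\<lambda>\<omega>. (T \<omega>, Y \<omega>)" P] by (intro nn_integral_cmult) simp
  also have "(\<integral>\<^sup>+\<omega>. f2 (T \<omega>, Y \<omega>) \<partial>P) = emeasure ?M ?H"
    unfolding UR.emeasure_pair_measure_alt[OF H] by (rule nn_integral_cong) (rule sliceH[symmetric])
  finally show ?thesis .
qed

section \<open>Product laws of sequences\<close>

lemma (in prob_space) distr_pair_if_indep_set:
  assumes X[measurable]: "X \<in> M \<rightarrow>\<^sub>M A" and Y[measurable]: "Y \<in> M \<rightarrow>\<^sub>M B"
    and indep: "indep_set (sets (vimage_algebra (space M) X A)) (sets (vimage_algebra (space M) Y B))"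
  shows "distr M (A \<Otimes>\<^sub>M B) (\<lambda>\<omega>. (X \<omega>, Y \<omega>)) = distr M A X \<Otimes>\<^sub>M distr M B Y"
proof (rule pair_measure_eqI[symmetric])
  show "sigma_finite_measure (distr M A X)" "sigma_finite_measure (distr M B Y)"
    using X Y by (auto intro!: prob_space_imp_sigma_finite prob_space_distr)
  fix a b assume "a \<in> sets (distr M A X)" "b \<in> sets (distr M B Y)"
  then have [measurable]: "a \<in> sets A" "b \<in> sets B" by simp_all
  have "prob (X -` a \<inter> space M \<inter> (Y -` b \<inter> space M)) = prob (X -` a \<inter> space M) * prob (Y -` b \<inter> space M)"
    by (intro indep_setD[OF indep] in_vimage_algebra) measurable
  moreover have "(\<lambda>\<omega>. (X \<omega>, Y \<omega>)) -` (a \<times> b) \<inter> space M = X -` a \<inter> space M \<inter> (Y -` b \<inter> space M)"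
    by auto
  ultimately show "emeasure (distr M A X) a * emeasure (distr M B Y) b =
      emeasure (distr M (A \<Otimes>\<^sub>M B) (\<lambda>\<omega>. (X \<omega>, Y \<omega>))) (a \<times> b)"
    by (simp add: emeasure_distr emeasure_eq_measure ennreal_mult)
qed simp

lemma distr_PiM_split_off:
  assumes M: "\<And>i. i \<in> I \<Longrightarrow> prob_space (M i)" and n: "n \<in> I" and J: "J \<subseteq> I" "n \<notin> J"
  shows "distr (PiM I M) (M n \<Otimes>\<^sub>M PiM J M) (\<lambda>\<omega>. (\<omega> n, restrict \<omega> J)) = M n \<Otimes>\<^sub>M PiM J M"
    (is "distr _ ?Q ?split = ?Q")
proof -
  let ?K = "insert n J"
  have K: "?K \<subseteq> I" using n J by auto
  have "distr (PiM I M) ?Q ?split = distr (distr (PiM I M) (PiM ?K M) (\<lambda>\<omega>. restrict \<omega> ?K)) ?Q ?split"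
    using K measurable_restrict_subset[OF K, of M]
    by (subst distr_distr) (auto simp: comp_def Int_absorb1 Int_absorb2 subset_insertI intro!: distr_cong)
  also have "distr (PiM I M) (PiM ?K M) (\<lambda>\<omega>. restrict \<omega> ?K) = PiM ?K M"
    using distr_PiM_reindex[of I M "\<lambda>i. i" ?K] K M by (auto simp: restrict_def)
  also have "\<dots> = distr ?Q (PiM ?K M) (\<lambda>(x, X). X(n := x))"
    using M n J by (intro distr_pair_PiM_eq_PiM[symmetric]) auto
  also have "distr \<dots> ?Q ?split = distr ?Q ?Q (\<lambda>v. v)"
  proof (subst distr_distr)
    show "?split \<in> PiM ?K M \<rightarrow>\<^sub>M ?Q"
      by (auto intro!: measurable_Pair measurable_restrict_subset)
    show "distr ?Q ?Q (?split \<circ> (\<lambda>(x, X). X(n := x))) = distr ?Q ?Q (\<lambda>v. v)"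
      using J(2) by (intro distr_cong) (auto simp: space_pair_measure space_PiM PiE_def extensional_restrict restrict_upd)
  qed simp
  finally show ?thesis
    unfolding distr_id .
qed

section \<open>The error sequence of a conformal predictor\<close>

text \<open>
  The hypotheses specialised to the law of the observations, a single member of the model.
  Independence of the observations and the random numbers takes the form of a product law, which is
  what the integrations below work with.
\<close>

locale conformal_setting = prob_space M
  for M :: "'w measure" +
  fixes \<Sigma> :: "nat \<Rightarrow> 's measure"
    and S :: "nat \<Rightarrow> (nat \<Rightarrow> 'k::finite obs) \<Rightarrow> 's"
    and \<kappa> :: "nat \<Rightarrow> 's \<Rightarrow> (nat \<Rightarrow> 'k obs) measure"
    and A :: "nat \<Rightarrow> 's \<times> 'k obs \<Rightarrow> real"
    and \<zeta> :: "'w \<Rightarrow> nat \<Rightarrow> 'k obs"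
    and \<tau> :: "'w \<Rightarrow> nat \<Rightarrow> real"
    and \<epsilon> :: real
  assumes stat: "statistics \<Sigma> S"
    and transitive: "algebraically_transitive \<Sigma> S"
    and cond_indep: "n \<ge> 1 \<Longrightarrow> cond_indep_var (distr M obs_inf \<zeta>) (obs_fin n) (\<lambda>z. restrict z {1..n})
      (PiM {n + 1..} (\<lambda>_. borel)) (\<lambda>z. restrict z {n + 1..}) (\<Sigma> n) (\<lambda>z. S n (restrict z {1..n}))"
    and cond_distr: "n \<ge> 1 \<Longrightarrow> regular_cond_distr (distr M obs_inf \<zeta>) (\<lambda>z. restrict z {1..n}) (obs_fin n)
      (\<lambda>z. S n (restrict z {1..n})) (\<Sigma> n) (\<kappa> n)"
    and nonconf: "nonconformity_measure \<Sigma> A"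
    and obs[measurable]: "\<zeta> \<in> M \<rightarrow>\<^sub>M obs_inf"
    and rnd[measurable]: "\<tau> \<in> M \<rightarrow>\<^sub>M unif_inf"
    and joint: "distr M (obs_inf \<Otimes>\<^sub>M unif_inf) (\<lambda>\<omega>. (\<zeta> \<omega>, \<tau> \<omega>)) = distr M obs_inf \<zeta> \<Otimes>\<^sub>M unif_inf"
    and eps: "0 < \<epsilon>" "\<epsilon> < 1"
begin

abbreviation stat_at :: "nat \<Rightarrow> 'w \<Rightarrow> 's" where
  "stat_at n \<omega> \<equiv> S n (restrict (\<zeta> \<omega>) {1..n})"

abbreviation error :: "nat \<Rightarrow> 'w \<Rightarrow> nat" where
  "error n \<omega> \<equiv> err S \<kappa> A \<epsilon> n (\<zeta> \<omega>) (\<tau> \<omega>)"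

abbreviation future_space :: "nat \<Rightarrow> (('s \<times> (nat \<Rightarrow> 'k obs)) \<times> (nat \<Rightarrow> real)) measure" where
  "future_space n \<equiv> (\<Sigma> n \<Otimes>\<^sub>M PiM {n + 1..} (\<lambda>_. borel)) \<Otimes>\<^sub>M PiM {n + 1..} (\<lambda>_. unif)"

text \<open>
  What remains of the data after step \<open>n\<close>, with the first \<open>n\<close> observations summarised by their
  statistic and the first \<open>n\<close> random numbers forgotten.
\<close>

definition future :: "nat \<Rightarrow> 'w \<Rightarrow> ('s \<times> (nat \<Rightarrow> 'k obs)) \<times> (nat \<Rightarrow> real)" where
  "future n \<omega> = ((stat_at n \<omega>, restrict (\<zeta> \<omega>) {n + 1..}), restrict (\<tau> \<omega>) {n + 1..})"

lemma measurable_S[measurable]: "S n \<in> obs_fin n \<rightarrow>\<^sub>M \<Sigma> n"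
  using stat by (simp add: statistics_def)

lemma measurable_first[measurable]: "(\<lambda>z. restrict z {1..n}) \<in> obs_inf \<rightarrow>\<^sub>M obs_fin n"
  by (rule measurable_restrict_subset) auto

lemma measurable_rest[measurable]:
  "(\<lambda>z. restrict z {n + 1..}) \<in> obs_inf \<rightarrow>\<^sub>M PiM {n + 1..} (\<lambda>_. borel)"
  "(\<lambda>t. restrict t {n + 1..}) \<in> unif_inf \<rightarrow>\<^sub>M PiM {n + 1..} (\<lambda>_. unif)"
  by (rule measurable_restrict_subset, auto)+

lemma measurable_stat_at[measurable]: "stat_at n \<in> M \<rightarrow>\<^sub>M \<Sigma> n"
  by measurable

lemma measurable_future: "future n \<in> M \<rightarrow>\<^sub>M future_space n"
  unfolding future_def by measurable

lemma measurable_A: "n \<ge> 1 \<Longrightarrow> A n \<in> borel_measurable (\<Sigma> (n - 1) \<Otimes>\<^sub>M borel)"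
  using nonconf by (simp add: nonconformity_measure_def)

lemma measurable_score:
  assumes "n \<ge> 1"
  shows "score S A n \<in> borel_measurable (obs_fin n)"
proof -
  have [measurable]: "(\<lambda>z. restrict z {1..n - 1}) \<in> obs_fin n \<rightarrow>\<^sub>M obs_fin (n - 1)"
    by (rule measurable_restrict_subset) auto
  have [measurable]: "(\<lambda>z. z n) \<in> obs_fin n \<rightarrow>\<^sub>M borel"
    using assms by (intro measurable_component_singleton) auto
  note measurable_A[OF assms, measurable]
  show ?thesis
    unfolding score_def by measurable
qed

lemma measurable_\<kappa>: "n \<ge> 1 \<Longrightarrow> \<kappa> n \<in> \<Sigma> n \<rightarrow>\<^sub>M prob_algebra (obs_fin n)"
  using cond_distr by (simp add: regular_cond_distr_def)

lemma score_first:
  "n \<ge> 1 \<Longrightarrow> score S A n (restrict z {1..n}) = A n (S (n - 1) (restrict z {1..n - 1}), z n)"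
  by (simp add: score_def Int_absorb1)

lemma error_eq:
  assumes n: "n \<ge> 1" and \<omega>: "\<omega> \<in> space M"
  shows "error n \<omega> = (if smoothed_p (\<kappa> n (stat_at n \<omega>)) (score S A n)
      (A n (stat_at (n - 1) \<omega>, \<zeta> \<omega> n)) (\<tau> \<omega> n) \<le> \<epsilon> then 1 else 0)"
proof -
  have "stat_at n \<omega> \<in> space (\<Sigma> n)"
    using measurable_space[OF measurable_stat_at \<omega>] .
  then have "\<kappa> n (stat_at n \<omega>) \<in> space (prob_algebra (obs_fin n))"
    by (rule measurable_space[OF measurable_\<kappa>[OF n]])
  then have "space (\<kappa> n (stat_at n \<omega>)) = space (obs_fin n)"
    by (auto simp: space_prob_algebra dest: sets_eq_imp_space_eq)
  moreover have "(restrict (\<zeta> \<omega>) {1..n - 1})(n := \<zeta> \<omega> n) = restrict (\<zeta> \<omega>) {1..n}"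
    using n by (auto simp: fun_eq_iff restrict_def)
  ultimately show ?thesis
    using n by (simp add: err_def prediction_region_def p_value_def smoothed_p_def score_first not_less del: One_nat_def)
qed

text \<open>
  As the error is \<open>0\<close> or \<open>1\<close>, all its events come from the single event \<open>error n \<omega> = 1\<close>.
\<close>

lemma error_vimage:
  "error n -` B \<inter> space M = (if 1 \<in> B then {\<omega> \<in> space M. error n \<omega> = 1} else {}) \<union>
     (if 0 \<in> B then space M - {\<omega> \<in> space M. error n \<omega> = 1} else {})"
proof (rule set_eqI)
  fix \<omega>
  have "error n \<omega> = 0 \<or> error n \<omega> = 1"
    by (simp add: err_def)
  then show "\<omega> \<in> error n -` B \<inter> space M \<longleftrightarrow> \<omega> \<in> (if 1 \<in> B then {\<omega> \<in> space M. error n \<omega> = 1} else {}) \<union>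
     (if 0 \<in> B then space M - {\<omega> \<in> space M. error n \<omega> = 1} else {})"
    by auto
qed

text \<open>
  The bound on \<open>n\<close> matches the range of algebraic transitivity, which describes \<open>S\<^sub>n\<close> from
  \<open>n = 2\<close> on; the future after step \<open>1\<close> is the earliest one that the argument conditions on.
\<close>

lemma stat_at_Suc:
  assumes "n \<ge> 1"
  obtains F where "F \<in> \<Sigma> n \<Otimes>\<^sub>M borel \<rightarrow>\<^sub>M \<Sigma> (Suc n)"
    "\<And>\<omega>. \<omega> \<in> space M \<Longrightarrow> stat_at (Suc n) \<omega> = F (stat_at n \<omega>, \<zeta> \<omega> (Suc n))"
proof -
  obtain F where F: "\<And>n. n \<ge> 2 \<Longrightarrow> F n \<in> \<Sigma> (n - 1) \<Otimes>\<^sub>M borel \<rightarrow>\<^sub>M \<Sigma> n"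
    "\<And>n z. n \<ge> 2 \<Longrightarrow> z \<in> space (obs_fin n) \<Longrightarrow> S n z = F n (S (n - 1) (restrict z {1..n - 1}), z n)"
    using transitive unfolding algebraically_transitive_def by metis
  show thesis
  proof
    show "F (Suc n) \<in> \<Sigma> n \<Otimes>\<^sub>M borel \<rightarrow>\<^sub>M \<Sigma> (Suc n)"
      using F(1)[of "Suc n"] assms by simp
    fix \<omega>
    have "restrict (restrict (\<zeta> \<omega>) {1..Suc n}) {1..n} = restrict (\<zeta> \<omega>) {1..n}"
      by (auto simp: fun_eq_iff restrict_def)
    then show "stat_at (Suc n) \<omega> = F (Suc n) (stat_at n \<omega>, \<zeta> \<omega> (Suc n))"
      using F(2)[of "Suc n" "restrict (\<zeta> \<omega>) {1..Suc n}"] assms by (simp add: space_PiM)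
  qed
qed

lemma measurable_error_of:
  assumes "n \<ge> 1" and H: "space H = space M" and "stat_at n \<in> H \<rightarrow>\<^sub>M \<Sigma> n"
    and "(\<lambda>\<omega>. A n (stat_at (n - 1) \<omega>, \<zeta> \<omega> n)) \<in> borel_measurable H"
    and "(\<lambda>\<omega>. \<tau> \<omega> n) \<in> borel_measurable H"
  shows "error n \<in> H \<rightarrow>\<^sub>M count_space UNIV"
proof -
  have [measurable]: "(\<lambda>\<omega>. smoothed_p (\<kappa> n (stat_at n \<omega>)) (score S A n)
      (A n (stat_at (n - 1) \<omega>, \<zeta> \<omega> n)) (\<tau> \<omega> n)) \<in> borel_measurable H"
    using measurable_compose[OF assms(3) measurable_\<kappa>[OF assms(1)]] assms measurable_score
    by (intro measurable_smoothed_p[where L="obs_fin n"]) auto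
  have "(\<lambda>\<omega>. if smoothed_p (\<kappa> n (stat_at n \<omega>)) (score S A n)
      (A n (stat_at (n - 1) \<omega>, \<zeta> \<omega> n)) (\<tau> \<omega> n) \<le> \<epsilon> then 1 else 0 :: nat) \<in> H \<rightarrow>\<^sub>M count_space UNIV"
    by measurable
  then show ?thesis
    by (rule measurable_cong[THEN iffD1, rotated]) (simp only: error_eq[OF assms(1)] H)
qed

lemma measurable_\<tau>_component: "n \<ge> 1 \<Longrightarrow> (\<lambda>\<omega>. \<tau> \<omega> n) \<in> M \<rightarrow>\<^sub>M unif"
  using measurable_compose[OF rnd measurable_component_singleton[of n "{1..}"]] by simp

lemma measurable_error:
  assumes "n \<ge> 1"
  shows "error n \<in> M \<rightarrow>\<^sub>M count_space UNIV"
proof (rule measurable_error_of[OF assms refl measurable_stat_at])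
  show "(\<lambda>\<omega>. \<tau> \<omega> n) \<in> borel_measurable M"
    using measurable_\<tau>_component[OF assms] by (simp cong: measurable_cong_sets)
  have [measurable]: "(\<lambda>\<omega>. \<zeta> \<omega> n) \<in> M \<rightarrow>\<^sub>M borel"
    using measurable_compose[OF obs measurable_component_singleton[of n "{1..}"]] assms by simp
  note measurable_A[OF assms, measurable]
  show "(\<lambda>\<omega>. A n (stat_at (n - 1) \<omega>, \<zeta> \<omega> n)) \<in> borel_measurable M"
    by measurable
qed

text \<open>
  This is where algebraic transitivity enters: the statistic and the score at step \<open>n + 1\<close> are
  functions of the statistic at step \<open>n\<close> and the next observation.  The algebra of \<open>H\<close> is left open
  so that the step can be iterated from any starting index.
\<close>

lemma future_step:
  assumes n: "n \<ge> 1" and H: "space H = space M" and fut: "future n \<in> H \<rightarrow>\<^sub>M future_space n"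
  shows "future (Suc n) \<in> H \<rightarrow>\<^sub>M future_space (Suc n)" and "error (Suc n) \<in> H \<rightarrow>\<^sub>M count_space UNIV"
proof -
  have T[measurable]: "stat_at n \<in> H \<rightarrow>\<^sub>M \<Sigma> n"
    and Y[measurable]: "(\<lambda>\<omega>. restrict (\<zeta> \<omega>) {n + 1..}) \<in> H \<rightarrow>\<^sub>M PiM {n + 1..} (\<lambda>_. borel)"
    and R[measurable]: "(\<lambda>\<omega>. restrict (\<tau> \<omega>) {n + 1..}) \<in> H \<rightarrow>\<^sub>M PiM {n + 1..} (\<lambda>_. unif)"
    using measurable_compose[OF measurable_compose[OF fut measurable_fst] measurable_fst]
      measurable_compose[OF measurable_compose[OF fut measurable_fst] measurable_snd]
      measurable_compose[OF fut measurable_snd]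
    by (simp_all add: future_def)
  have y[measurable]: "(\<lambda>\<omega>. \<zeta> \<omega> (Suc n)) \<in> H \<rightarrow>\<^sub>M borel"
    using measurable_compose[OF Y measurable_component_singleton[of "Suc n"]] by simp
  have "(\<lambda>\<omega>. \<tau> \<omega> (Suc n)) \<in> H \<rightarrow>\<^sub>M unif"
    using measurable_compose[OF R measurable_component_singleton[of "Suc n"]] by simp
  then have r[measurable]: "(\<lambda>\<omega>. \<tau> \<omega> (Suc n)) \<in> borel_measurable H"
    by (simp cong: measurable_cong_sets)
  obtain F where F[measurable]: "F \<in> \<Sigma> n \<Otimes>\<^sub>M borel \<rightarrow>\<^sub>M \<Sigma> (Suc n)"
    and F_eq: "\<And>\<omega>. \<omega> \<in> space M \<Longrightarrow> stat_at (Suc n) \<omega> = F (stat_at n \<omega>, \<zeta> \<omega> (Suc n))"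
    using stat_at_Suc[OF n] by blast
  have "(\<lambda>\<omega>. F (stat_at n \<omega>, \<zeta> \<omega> (Suc n))) \<in> H \<rightarrow>\<^sub>M \<Sigma> (Suc n)"
    by measurable
  then have T'[measurable]: "stat_at (Suc n) \<in> H \<rightarrow>\<^sub>M \<Sigma> (Suc n)"
    by (rule measurable_cong[THEN iffD1, rotated]) (simp only: F_eq H)
  have Int: "{n + 1..} \<inter> {Suc n + 1..} = {Suc n + 1..}" by auto
  have "(\<lambda>\<omega>. restrict (restrict (\<zeta> \<omega>) {n + 1..}) {Suc n + 1..}) \<in> H \<rightarrow>\<^sub>M PiM {Suc n + 1..} (\<lambda>_. borel)"
    by (rule measurable_compose[OF Y measurable_restrict_subset]) auto
  moreover have "(\<lambda>\<omega>. restrict (restrict (\<tau> \<omega>) {n + 1..}) {Suc n + 1..}) \<in> H \<rightarrow>\<^sub>M PiM {Suc n + 1..} (\<lambda>_. unif)"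
    by (rule measurable_compose[OF R measurable_restrict_subset]) auto
  ultimately show "future (Suc n) \<in> H \<rightarrow>\<^sub>M future_space (Suc n)"
    unfolding future_def restrict_restrict Int by (intro measurable_Pair T')
  have "(\<lambda>\<omega>. A (Suc n) (stat_at n \<omega>, \<zeta> \<omega> (Suc n))) \<in> borel_measurable H"
    using measurable_compose[OF measurable_Pair[OF T y], of "A (Suc n)" borel] measurable_A[of "Suc n"] by simp
  then show "error (Suc n) \<in> H \<rightarrow>\<^sub>M count_space UNIV"
    by (intro measurable_error_of H T' r) simp_all
qed

definition future_algebra :: "nat \<Rightarrow> 'w measure" where
  "future_algebra n = vimage_algebra (space M) (future n) (future_space n)"

lemma space_future_algebra: "space (future_algebra n) = space M"
  by (simp add: future_algebra_def)

lemma future_measurable_earlier: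
  assumes "1 \<le> m" "m \<le> n"
  shows "future n \<in> future_algebra m \<rightarrow>\<^sub>M future_space n"
  using assms(2)
proof (induction n rule: dec_induct)
  case base
  have "future m \<in> space M \<rightarrow> space (future_space m)"
    using measurable_space[OF measurable_future] by auto
  then show ?case
    unfolding future_algebra_def by (rule measurable_vimage_algebra1)
next
  case (step n)
  then show ?case
    using assms(1) by (intro future_step(1)) (auto simp: space_future_algebra)
qed

lemma error_measurable_earlier:
  assumes "1 \<le> m" "m < n"
  shows "error n \<in> future_algebra m \<rightarrow>\<^sub>M count_space UNIV"
proof -
  obtain l where l: "n = Suc l" "m \<le> l"
    using assms(2) by (cases n) auto
  then show ?thesis
    using assms(1) future_step(2)[of l "future_algebra m"] future_measurable_earlier[of m l]
    by (auto simp: space_future_algebra)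
qed

text \<open>
  The observations and the random numbers are moved to the product of their laws, with \<open>\<tau>\<^sub>n\<close> split
  off from the later random numbers, where \<open>error_event_product\<close> evaluates both sides.
\<close>

lemma prob_error_given_future:
  assumes n: "n \<ge> 1" and H: "H \<in> sets (future_algebra n)"
  shows "prob ({\<omega> \<in> space M. error n \<omega> = 1} \<inter> H) = \<epsilon> * prob H"
proof -
  let ?P = "distr M obs_inf \<zeta>" and ?R = "PiM {n + 1..} (\<lambda>_. unif)"
  interpret P: prob_space ?P by (rule prob_space_distr) (rule obs)
  interpret UI: prob_space unif_inf by (intro prob_space_PiM prob_space_unif)
  interpret R: prob_space ?R by (intro prob_space_PiM prob_space_unif)
  note measurable_score[OF n, measurable] measurable_\<kappa>[OF n, measurable]
  let ?split = "\<lambda>t. (t n, restrict t {n + 1..})"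
  let ?J = "\<lambda>\<omega>. (\<zeta> \<omega>, ?split (\<tau> \<omega>))"
  have split[measurable]: "?split \<in> unif_inf \<rightarrow>\<^sub>M unif \<Otimes>\<^sub>M ?R"
    using n by (intro measurable_Pair measurable_rest measurable_component_singleton) auto
  have J[measurable]: "?J \<in> M \<rightarrow>\<^sub>M ?P \<Otimes>\<^sub>M (unif \<Otimes>\<^sub>M ?R)"
    using measurable_Pair[OF obs measurable_compose[OF rnd split]] by (simp cong: measurable_cong_sets)
  have law: "distr M (?P \<Otimes>\<^sub>M (unif \<Otimes>\<^sub>M ?R)) ?J = ?P \<Otimes>\<^sub>M (unif \<Otimes>\<^sub>M ?R)"
  proof -
    have "?P \<Otimes>\<^sub>M (unif \<Otimes>\<^sub>M ?R) = distr ?P ?P (\<lambda>z. z) \<Otimes>\<^sub>M distr unif_inf (unif \<Otimes>\<^sub>M ?R) ?split"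
      using n by (subst distr_PiM_split_off) (auto intro: prob_space_unif)
    also have "\<dots> = distr (?P \<Otimes>\<^sub>M unif_inf) (?P \<Otimes>\<^sub>M (unif \<Otimes>\<^sub>M ?R)) (\<lambda>(z, t). (z, ?split t))"
    proof (intro pair_measure_distr split)
      show "sigma_finite_measure (distr unif_inf (unif \<Otimes>\<^sub>M ?R) ?split)"
        using UI.prob_space_distr[OF split] by (rule prob_space_imp_sigma_finite)
    qed simp
    also have "\<dots> = distr M (?P \<Otimes>\<^sub>M (unif \<Otimes>\<^sub>M ?R)) ?J"
    proof -
      have m: "(\<lambda>w. (fst w, ?split (snd w))) \<in> obs_inf \<Otimes>\<^sub>M unif_inf \<rightarrow>\<^sub>M ?P \<Otimes>\<^sub>M (unif \<Otimes>\<^sub>M ?R)"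
        using measurable_Pair[OF measurable_fst measurable_compose[OF measurable_snd split]]
        by (simp only: measurable_cong_sets[OF refl sets_pair_measure_cong[OF sets_distr refl]])
      show ?thesis
        unfolding joint[symmetric] case_prod_beta by (subst distr_distr[OF m measurable_Pair[OF obs rnd]]) (simp add: comp_def)
    qed
    finally show ?thesis ..
  qed
  obtain W where W: "W \<in> sets (future_space n)" and H_eq: "H = future n -` W \<inter> space M"
  proof -
    have "future n \<in> space M \<rightarrow> space (future_space n)"
      using measurable_space[OF measurable_future] by auto
    from sets_vimage_algebra2[OF this] show ?thesis
      using that H by (auto simp: future_algebra_def)
  qed
  let ?Q = "?P \<Otimes>\<^sub>M (unif \<Otimes>\<^sub>M ?R)"
  let ?T = "\<lambda>z. S n (restrict z {1..n})"
  let ?p = "\<lambda>w. smoothed_p (\<kappa> n (?T (fst w))) (score S A n) (score S A n (restrict (fst w) {1..n})) (fst (snd w))"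
  let ?V = "\<lambda>w. ((?T (fst w), restrict (fst w) {n + 1..}), snd (snd w))"
  let ?E' = "{w \<in> space ?Q. ?p w \<le> \<epsilon> \<and> ?V w \<in> W}" and ?H' = "{w \<in> space ?Q. ?V w \<in> W}"
  have [measurable]: "W \<in> sets (future_space n)" by fact
  have p[measurable]: "?p \<in> borel_measurable ?Q"
    by (rule measurable_smoothed_p[where L="obs_fin n"]) measurable
  have V[measurable]: "?V \<in> ?Q \<rightarrow>\<^sub>M future_space n"
    by measurable
  have H': "?H' \<in> sets ?Q" and E': "?E' \<in> sets ?Q"
    by measurable
  have J_space: "?J \<omega> \<in> space ?Q" if "\<omega> \<in> space M" for \<omega>
    using measurable_space[OF J that] .
  have "emeasure ?Q ?E' = ennreal \<epsilon> * emeasure ?Q ?H'"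
  proof (rule error_event_product[OF P.prob_space_axioms _ _ _ cond_distr[OF n] cond_indep[OF n] _ R.prob_space_axioms W eps])
  qed measurable
  then have "emeasure M (?J -` ?E' \<inter> space M) = ennreal \<epsilon> * emeasure M (?J -` ?H' \<inter> space M)"
    using emeasure_distr[OF J E'] emeasure_distr[OF J H'] unfolding law by simp
  also have "?J -` ?H' \<inter> space M = H"
    using J_space by (auto simp: H_eq future_def)
  also have "?J -` ?E' \<inter> space M = {\<omega> \<in> space M. error n \<omega> = 1} \<inter> H"
    using J_space n by (auto simp: H_eq future_def error_eq score_first simp del: One_nat_def split: if_splits)
  finally show ?thesis
    using eps by (simp add: emeasure_eq_measure ennreal_mult[symmetric])
qed

lemma prob_error: "n \<ge> 1 \<Longrightarrow> prob {\<omega> \<in> space M. error n \<omega> = 1} = \<epsilon>"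
  using prob_error_given_future[of n "space M"] sets.top[of "future_algebra n"]
  by (simp add: space_future_algebra prob_space Int_absorb2)

lemma indep_errors: "indep_vars (\<lambda>_. count_space UNIV) error {1..}"
proof (rule indep_vars_if_backward_indep[where G=future_algebra])
  fix n and B :: "nat set" and H assume n: "n \<in> {1::nat..}" and H: "H \<in> sets (future_algebra n)"
  let ?E = "{\<omega> \<in> space M. error n \<omega> = 1}"
  have "future_algebra n = vimage_algebra (space M) (future n) (future_space n)"
    by (simp add: future_algebra_def)
  then have H'[measurable]: "H \<in> events"
    using sets_image_in_sets[OF refl measurable_future, of n] H by auto
  have [measurable]: "error n \<in> M \<rightarrow>\<^sub>M count_space UNIV"
    using n by (intro measurable_error) simp
  have E: "?E \<in> events" by measurable
  have space_E: "?E \<union> space M = space M" by auto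
  have pE: "prob ?E = \<epsilon>"
    using n by (intro prob_error) simp
  have pEH: "prob (?E \<inter> H) = \<epsilon> * prob H"
    using n by (intro prob_error_given_future H) simp
  have pC: "prob (space M - ?E) = 1 - \<epsilon>"
    using prob_compl[OF E] pE by simp
  have "prob H = prob (?E \<inter> H) + prob ((space M - ?E) \<inter> H)"
    using E H' sets.sets_into_space[OF H'] by (subst finite_measure_Union[symmetric]) (auto intro!: arg_cong[where f=prob])
  then have pCH: "prob ((space M - ?E) \<inter> H) = (1 - \<epsilon>) * prob H"
    using pEH by (simp add: algebra_simps)
  show "prob (error n -` B \<inter> space M \<inter> H) = prob (error n -` B \<inter> space M) * prob H"
    unfolding error_vimage using pE pEH pC pCH sets.sets_into_space[OF H']
    by (cases "0 \<in> B"; cases "1 \<in> B") (simp_all add: space_E Int_absorb1 prob_space del: One_nat_def)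
qed (use measurable_error error_measurable_earlier in \<open>auto simp: space_future_algebra\<close>)

lemma distr_error:
  assumes "n \<ge> 1"
  shows "distr M (count_space UNIV) (error n) = measure_pmf (map_pmf of_bool (bernoulli_pmf \<epsilon>))"
proof (rule measure_eqI_countable[where A=UNIV])
  note measurable_error[OF assms, measurable]
  fix a :: nat
  have p1: "prob {\<omega> \<in> space M. error n \<omega> = 1} = \<epsilon>"
    using assms by (rule prob_error)
  have E: "{\<omega> \<in> space M. error n \<omega> = 1} \<in> events"
    by measurable
  have vimage: "error n -` {a} \<inter> space M = (if a = 1 then {\<omega> \<in> space M. error n \<omega> = 1}
      else if a = 0 then space M - {\<omega> \<in> space M. error n \<omega> = 1} else {})"
    unfolding error_vimage by auto
  have pmf: "pmf (map_pmf of_bool (bernoulli_pmf \<epsilon>)) a = (if a = 1 then \<epsilon> else if a = 0 then 1 - \<epsilon> else 0)"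
  proof -
    have "pmf (map_pmf of_bool (bernoulli_pmf \<epsilon>)) a = measure (bernoulli_pmf \<epsilon>) (of_bool -` {a})"
      by (simp add: pmf_map)
    also have "(of_bool -` {a} :: bool set) = (if a = 1 then {True} else if a = 0 then {False} else {})"
    proof (rule set_eqI)
      fix x
      show "x \<in> of_bool -` {a} \<longleftrightarrow> x \<in> (if a = 1 then {True} else if a = 0 then {False} else {})"
        by (cases x) auto
    qed
    finally show ?thesis
      using eps by (simp add: measure_pmf_single)
  qed
  show "emeasure (distr M (count_space UNIV) (error n)) {a} = emeasure (map_pmf of_bool (bernoulli_pmf \<epsilon>)) {a}"
    using p1 prob_compl[OF E] unfolding emeasure_pmf_single pmf
    by (simp add: emeasure_distr vimage emeasure_eq_measure)
qed auto

end

section \<open>Validity of smoothed conformal predictors\<close>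

theorem corollary1:
  fixes \<P> :: "(nat \<Rightarrow> 'k::finite obs) measure set"
    and \<Sigma> :: "nat \<Rightarrow> 's measure"
    and S :: "nat \<Rightarrow> (nat \<Rightarrow> 'k obs) \<Rightarrow> 's"
    and \<kappa> :: "nat \<Rightarrow> 's \<Rightarrow> (nat \<Rightarrow> 'k obs) measure"
    and A :: "nat \<Rightarrow> 's \<times> 'k obs \<Rightarrow> real"
    and P :: "(nat \<Rightarrow> 'k obs) measure"
    and M :: "'w measure"
    and \<zeta> :: "'w \<Rightarrow> nat \<Rightarrow> 'k obs"
    and \<tau> :: "'w \<Rightarrow> nat \<Rightarrow> real"
    and \<epsilon> :: real
  assumes model: "statistical_model \<P>"
    and atts: "ATTS \<P> \<Sigma> S"
    and cond_distr: "\<And>n. n \<ge> 1 \<Longrightarrow> common_cond_distr \<P> \<Sigma> S n (\<kappa> n)"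
    and nonconf: "nonconformity_measure \<Sigma> A"
    and P: "P \<in> \<P>"
    and M: "prob_space M"
    and obs: "\<zeta> \<in> measurable M obs_inf" "distr M obs_inf \<zeta> = P"
    and rnd: "\<tau> \<in> measurable M unif_inf" "distr M unif_inf \<tau> = unif_inf"
    and indep: "prob_space.indep_set M (sets (vimage_algebra (space M) \<zeta> obs_inf))
                  (sets (vimage_algebra (space M) \<tau> unif_inf))"
    and eps: "0 < \<epsilon>" "\<epsilon> < 1"
  shows "prob_space.indep_vars M (\<lambda>_. count_space UNIV)
           (\<lambda>n \<omega>. err S \<kappa> A \<epsilon> n (\<zeta> \<omega>) (\<tau> \<omega>)) {1..} \<and>
         (\<forall>n\<ge>1. distr M (count_space UNIV) (\<lambda>\<omega>. err S \<kappa> A \<epsilon> n (\<zeta> \<omega>) (\<tau> \<omega>)) =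
           measure_pmf (map_pmf of_bool (bernoulli_pmf \<epsilon>)))"
proof -
  interpret prob_space M by fact
  have joint: "distr M (obs_inf \<Otimes>\<^sub>M unif_inf) (\<lambda>\<omega>. (\<zeta> \<omega>, \<tau> \<omega>)) = distr M obs_inf \<zeta> \<Otimes>\<^sub>M unif_inf"
    using distr_pair_if_indep_set[OF obs(1) rnd(1) indep] unfolding rnd(2) .
  interpret conformal_setting M \<Sigma> S \<kappa> A \<zeta> \<tau> \<epsilon>
  proof unfold_locales
    show "statistics \<Sigma> S" "algebraically_transitive \<Sigma> S"
      using atts by (auto simp: ATTS_def)
    show "cond_indep_var (distr M obs_inf \<zeta>) (obs_fin n) (\<lambda>z. restrict z {1..n})
      (PiM {n + 1..} (\<lambda>_. borel)) (\<lambda>z. restrict z {n + 1..}) (\<Sigma> n) (\<lambda>z. S n (restrict z {1..n}))"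
      if "1 \<le> n" for n
      using atts P that unfolding obs(2) ATTS_def totally_sufficient_def by blast
    show "regular_cond_distr (distr M obs_inf \<zeta>) (\<lambda>z. restrict z {1..n}) (obs_fin n)
      (\<lambda>z. S n (restrict z {1..n})) (\<Sigma> n) (\<kappa> n)" if "1 \<le> n" for n
      using cond_distr[OF that] P unfolding obs(2) common_cond_distr_def by blast
  qed (fact nonconf obs(1) rnd(1) joint eps)+
  show ?thesis
    using indep_errors distr_error by blast
qed

end
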